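(* Let $\mathcal V$ be a (nonempty) smooth submanifold without boundary of $\mathcal W(\mathcal Y,\mathcal E)$ such that: (i) $\dim\mathcal V=\dim\operatorname{e-hull}(\mathcal V)$; (ii) there exist a finite-dimensional (Hausdorff) real topological vector space $\mathcal U$, a linear map $\phi\colon\mathcal F(\mathcal Y,\mathcal E)\to\mathcal U$ and $C\in\mathcal U$ such that $\mathcal V=\mathcal W(\mathcal Y,\mathcal E)\cap\mathcal L$, where $\mathcal L=\{F\in\mathcal F(\mathcal Y,\mathcal E):\phi(F)=C\}$. Then $\mathcal V$ forms an e-family.
   Context: Let $\mathcal Y$ be a finite set and $\mathcal E\subset\mathcal Y^2$ a nonempty edge set such that the digraph $(\mathcal Y,\mathcal E)$ is strongly connected. $\mathcal F(\mathcal Y,\mathcal E)=\mathbb R^{\mathcal E}$ is the space of real functions on $\mathcal E$, identified with real $\mathcal Y\times\mathcal Y$ matrices vanishing outside $\mathcal E$; $\mathcal F^+(\mathcal Y,\mathcal E)$ is the subset of those that are strictly positive on $\mathcal E$; $\mathcal W(\mathcal Y,\mathcal E)\subset\mathcal F^+(\mathcal Y,\mathcal E)$ is the set of row-stochastic ones, a smooth manifold as a relatively open subset of the affine space of elements of $\mathcal F(\mathcal Y,\mathcal E)$ with all row sums equal to $1$. E-families: for $F\in\mathcal F^+(\mathcal Y,\mathcal E)$ with Perron–Frobenius root $\rho_F$ and positive right eigenvector $v_F$, put $\mathfrak s(F)(y,y')=\frac{F(y,y')v_F(y')}{\rho_F v_F(y)}$, so $\mathfrak s(F)\in\mathcal W(\mathcal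 Y,\mathcal E)$. Let $\mathcal N(\mathcal Y,\mathcal E)$ be the linear space of $N\in\mathcal F(\mathcal Y,\mathcal E)$ of the form $N(y,y')=f(y')-f(y)+c$ with $f\in\mathbb R^{\mathcal Y}$, $c\in\mathbb R$. A set $\mathcal V\subset\mathcal W(\mathcal Y,\mathcal E)$ forms an e-family of dimension $d\ge 0$ if there are $K\in\mathcal F(\mathcal Y,\mathcal E)$ and $G_1,\dots,G_d\in\mathcal F(\mathcal Y,\mathcal E)$, linearly independent modulo $\mathcal N(\mathcal Y,\mathcal E)$, with $\mathcal V=\{\mathfrak s(\exp(K+\sum_{i=1}^d\theta^iG_i)):\theta\in\mathbb R^d\}$, where $\exp$ is applied entrywise on $\mathcal E$. The map $\mathfrak s\circ\exp$ induces a diffeomorphism $\mathcal F(\mathcal Y,\mathcal E)/\mathcal N(\mathcal Y,\mathcal E)\to\mathcal W(\mathcal Y,\mathcal E)$, through which an e-family of dimension $d$ is a $d$-dimensional smooth submanifold. E-hull: for $\mathcal V\subset\mathcal W(\mathcal Y,\mathcal E)$, $\operatorname{e-hull}(\mathcal V)$ is the set of all $\mathfrak s(\widetilde P)$ with $\log\widetilde P=\sum_{i=1}^k\alpha_i\log P_i$ (entrywise on $\mathcal E$), $k\in\mathbb N$, $\alpha\in\mathbb R^k$, $\sum_{i=1}^k\alpha_i=1$, $P_1,\dots,P_k\in\mathcal V$. It is the smallest e-family containing $\mathcal V$, and $\dim\operatorname{e-hull}(\mathcal V)$ is its dimension as an e-family. *)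

theory Defs
  imports "HOL-Analysis.Analysis"
begin

text \<open>
  The finite set of vertices is the universe of a finite type \<^typ>\<open>'y\<close>; the edge set \<open>E\<close> is an
  arbitrary subset of \<^typ>\<open>'y \<times> 'y\<close>. In a matrix \<open>A\<close> of type \<^typ>\<open>real^'y^'y\<close> the entry
  \<open>A $ x $ y\<close> has row index \<open>x\<close> and column index \<open>y\<close>.
\<close>

definition strongly_connected_digraph :: "('y \<times> 'y) set \<Rightarrow> bool" where
  "strongly_connected_digraph E \<longleftrightarrow> (\<forall>x y. (x, y) \<in> E\<^sup>*)"

definition edge_functions :: "('y::finite \<times> 'y) set \<Rightarrow> (real^'y^'y) set" where
  "edge_functions E = {F. \<forall>x y. (x, y) \<notin> E \<longrightarrow> F $ x $ y = 0}"

definition positive_edge_functions :: "('y::finite \<times> 'y) set \<Rightarrow> (real^'y^'y) set" where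
  "positive_edge_functions E = {F \<in> edge_functions E. \<forall>(x, y) \<in> E. F $ x $ y > 0}"

definition stochastic_matrices :: "('y::finite \<times> 'y) set \<Rightarrow> (real^'y^'y) set" where
  "stochastic_matrices E = {P \<in> positive_edge_functions E. \<forall>x. (\<Sum>y\<in>UNIV. P $ x $ y) = 1}"


subsection \<open>Exponential families of stochastic matrices\<close>

definition edge_exp :: "('y::finite \<times> 'y) set \<Rightarrow> real^'y^'y \<Rightarrow> real^'y^'y" where
  "edge_exp E F = (\<chi> x y. if (x, y) \<in> E then exp (F $ x $ y) else 0)"

definition edge_ln :: "('y::finite \<times> 'y) set \<Rightarrow> real^'y^'y \<Rightarrow> real^'y^'y" where
  "edge_ln E F = (\<chi> x y. if (x, y) \<in> E then ln (F $ x $ y) else 0)"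

definition complex_eigenvalues :: "real^'y^'y::finite \<Rightarrow> complex set" where
  "complex_eigenvalues F =
     {l. \<exists>w :: complex^'y. w \<noteq> 0 \<and> (\<chi> x y. complex_of_real (F $ x $ y)) *v w = l *s w}"

text \<open>
  The Perron--Frobenius root is the spectral radius (the supremum is over a finite nonempty set,
  hence a maximum). A positive eigenvector is unique up to a positive factor, so the choice made in
  \<open>pf_vector\<close> does not affect \<open>stoch_rescale\<close>.
\<close>

definition pf_root :: "real^'y^'y::finite \<Rightarrow> real" where
  "pf_root F = (SUP l \<in> complex_eigenvalues F. cmod l)"

definition pf_vector :: "real^'y^'y::finite \<Rightarrow> real^'y" where
  "pf_vector F = (SOME v. (\<forall>y. v $ y > 0) \<and> F *v v = pf_root F *\<^sub>R v)"

definition stoch_rescale :: "real^'y^'y::finite \<Rightarrow> real^'y^'y" where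
  "stoch_rescale F =
     (\<chi> x y. F $ x $ y * pf_vector F $ y / (pf_root F * pf_vector F $ x))"

definition null_functions :: "('y::finite \<times> 'y) set \<Rightarrow> (real^'y^'y) set" where
  "null_functions E =
     {N \<in> edge_functions E. \<exists>(f :: 'y \<Rightarrow> real) c. \<forall>(x, y) \<in> E. N $ x $ y = f y - f x + c}"

definition e_family :: "('y::finite \<times> 'y) set \<Rightarrow> nat \<Rightarrow> (real^'y^'y) set \<Rightarrow> bool" where
  "e_family E d V \<longleftrightarrow> V \<subseteq> stochastic_matrices E \<and>
     (\<exists>K \<in> edge_functions E. \<exists>G :: nat \<Rightarrow> real^'y^'y.
        (\<forall>i<d. G i \<in> edge_functions E) \<and>
        (\<forall>a :: nat \<Rightarrow> real. (\<Sum>i<d. a i *\<^sub>R G i) \<in> null_functions E \<longrightarrow> (\<forall>i<d. a i = 0)) \<and>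
        V = {stoch_rescale (edge_exp E (K + (\<Sum>i<d. \<theta> i *\<^sub>R G i))) | \<theta> :: nat \<Rightarrow> real. True})"

definition e_dim :: "('y::finite \<times> 'y) set \<Rightarrow> (real^'y^'y) set \<Rightarrow> nat" where
  "e_dim E V = (THE d. e_family E d V)"

definition e_hull :: "('y::finite \<times> 'y) set \<Rightarrow> (real^'y^'y) set \<Rightarrow> (real^'y^'y) set" where
  "e_hull E V = {stoch_rescale Q | Q. Q \<in> positive_edge_functions E \<and>
     (\<exists>(k :: nat) (\<alpha> :: nat \<Rightarrow> real) P. (\<forall>i<k. P i \<in> V) \<and> (\<Sum>i<k. \<alpha> i) = 1 \<and>
        edge_ln E Q = (\<Sum>i<k. \<alpha> i *\<^sub>R edge_ln E (P i)))}"


subsection \<open>Embedded submanifolds\<close>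

fun Ck_on :: "nat \<Rightarrow> ('a::euclidean_space \<Rightarrow> 'b::euclidean_space) \<Rightarrow> 'a set \<Rightarrow> bool" where
  "Ck_on 0 f U \<longleftrightarrow> continuous_on U f"
| "Ck_on (Suc k) f U \<longleftrightarrow> (\<forall>x\<in>U. f differentiable (at x)) \<and>
     (\<forall>v. Ck_on k (\<lambda>x. frechet_derivative f (at x) v) U)"

text \<open>
  \<open>Ck_on\<close> is only meaningful on open sets. On an arbitrary subset of a Euclidean space a map is
  smooth if it locally extends to a smooth map on an open set; on a relatively open subset of an
  affine subspace, such as \<open>stochastic_matrices E\<close>, this is smoothness in affine coordinates.
\<close>

definition smooth_map :: "('a::euclidean_space \<Rightarrow> 'b::euclidean_space) \<Rightarrow> 'a set \<Rightarrow> bool" where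
  "smooth_map f A \<longleftrightarrow> (\<forall>x\<in>A. \<exists>U g. open U \<and> x \<in> U \<and> (\<forall>k. Ck_on k g U) \<and> (\<forall>y\<in>U \<inter> A. g y = f y))"

text \<open>
  \<open>S\<close> is an embedded submanifold (without boundary) of dimension \<open>d\<close> of \<open>M\<close>: around each point
  of \<open>S\<close> there is a slice chart of \<open>M\<close>, that is a diffeomorphism \<open>\<phi>\<close> (with inverse \<open>\<psi>\<close>) from a
  relatively open subset \<open>U\<close> of \<open>M\<close> onto an open subset of a vector space \<open>D\<close>, mapping \<open>U \<inter> S\<close>
  onto the intersection of the image with a \<open>d\<close>-dimensional linear subspace \<open>T\<close>. As the model space
  \<open>D\<close> we allow any linear subspace of the ambient space of \<open>M\<close>, which is no restriction since the
  dimension of \<open>M\<close> is at most that of the ambient space.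
\<close>

definition embedded_submanifold :: "'a::euclidean_space set \<Rightarrow> nat \<Rightarrow> 'a set \<Rightarrow> bool" where
  "embedded_submanifold M d S \<longleftrightarrow> S \<subseteq> M \<and>
     (\<forall>p\<in>S. \<exists>U D T (\<phi> :: 'a \<Rightarrow> 'a) (\<psi> :: 'a \<Rightarrow> 'a).
        openin (top_of_set M) U \<and> p \<in> U \<and>
        subspace D \<and> openin (top_of_set D) (\<phi> ` U) \<and>
        smooth_map \<phi> U \<and> smooth_map \<psi> (\<phi> ` U) \<and> (\<forall>x\<in>U. \<psi> (\<phi> x) = x) \<and>
        subspace T \<and> T \<subseteq> D \<and> dim T = d \<and> \<phi> ` (U \<inter> S) = \<phi> ` U \<inter> T)"


subsection \<open>Linear constraints\<close>

definition linear_map_on :: "'a::real_vector set \<Rightarrow> ('a \<Rightarrow> 'b::real_vector) \<Rightarrow> bool" where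
  "linear_map_on S h \<longleftrightarrow>
     (\<forall>x\<in>S. \<forall>y\<in>S. h (x + y) = h x + h y) \<and> (\<forall>c. \<forall>x\<in>S. h (c *\<^sub>R x) = c *\<^sub>R h x)"

end

theory Submission
  imports Defs
begin

text \<open>
  By Perron--Frobenius theory every stochastic matrix \<open>P\<close> is determined by its logarithm modulo
  null functions, and every class of edge functions arises in this way. This gives a global chart
  \<open>log_class E\<close> of the stochastic matrices with inverse \<open>stoch_exp E\<close>, where both maps are continuous
  (\<open>continuous_on_log_class\<close>, \<open>continuous_on_stoch_exp\<close>) and e-families are exactly the preimages of nonempty
  affine subspaces (\<open>e_family_aff_dim_log_class\<close>, \<open>e_family_stoch_exp_affine\<close>). In particular the e-hull
  of \<open>V\<close> corresponds to the affine hull \<open>B\<close> of the image of \<open>V\<close> in the chart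
  (\<open>e_hull_eq_stoch_exp_affine_hull\<close>), and the assumption on dimensions says that \<open>B\<close> has the dimension
  of the manifold \<open>V\<close>.

  The image of \<open>V\<close> in \<open>B\<close> is open by invariance of domain, since the dimensions agree
  (\<open>openin_image_embedded_submanifold\<close>). It is also closed in \<open>B\<close>: it consists of the points of \<open>B\<close>
  whose stochastic matrix satisfies a linear constraint, which is a closed condition
  (\<open>closed_linear_fibre\<close>), pulled back along the continuous map \<open>stoch_exp E\<close>. As \<open>B\<close> is connected and
  \<open>V\<close> is nonempty, the image is all of \<open>B\<close>. So \<open>V\<close> is its own e-hull, and therefore an e-family.

  Continuity of \<open>stoch_exp E\<close> is the analytic point. It comes from the closed graph of the normalised
  Perron--Frobenius eigenvector (\<open>continuous_on_perron_vector\<close>), which rests on uniqueness of that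
  eigenvector and compactness of the simplex.
\<close>

section \<open>Perron--Frobenius theory for strongly connected digraphs\<close>

text \<open>
  Strong connectedness enters the Perron--Frobenius theory only in this form: a property that is
  inherited along edges and holds somewhere holds everywhere.
\<close>
lemma edge_closed_set_eq_UNIV:
  assumes "strongly_connected_digraph E" and "x \<in> S"
    and "\<And>x y. x \<in> S \<Longrightarrow> (x, y) \<in> E \<Longrightarrow> y \<in> S"
  shows "S = UNIV"
proof -
  have "y \<in> S" for y
  proof -
    have "(x, y) \<in> E\<^sup>*" using assms(1) by (auto simp: strongly_connected_digraph_def)
    then show ?thesis by (induction rule: rtrancl_induct) (use assms(2,3) in auto)
  qed
  then show ?thesis by auto
qed

text \<open>
  This excludes zero columns, so that no vector of the simplex is annihilated by a positive edge
  function. Going through the transitive closure from the tail of some edge also covers the digraph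
  with a single vertex, where the edge set has to be nonempty.
\<close>
lemma ex_incoming_edge:
  assumes "strongly_connected_digraph E" and "E \<noteq> {}"
  obtains x where "(x, y) \<in> E"
proof -
  obtain a b where ab: "(a, b) \<in> E" using assms(2) by auto
  have "(b, y) \<in> E\<^sup>*" using assms(1) by (auto simp: strongly_connected_digraph_def)
  then have "(a, y) \<in> E\<^sup>+" using ab by (rule rtrancl_into_trancl2[rotated])
  then show ?thesis using that by (meson tranclD2)
qed

lemma positive_edge_functions_nonneg:
  "F \<in> positive_edge_functions E \<Longrightarrow> 0 \<le> F $ x $ y"
  unfolding positive_edge_functions_def edge_functions_def
  by (cases "(x, y) \<in> E") (auto intro: less_imp_le)

text \<open>
  If an eigenvector vanishes at \<open>x\<close>, then so does the sum of nonnegative terms that computes its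
  image at \<open>x\<close>. Hence it vanishes at the head of every edge leaving \<open>x\<close>, and by strong connectedness
  everywhere.
\<close>
lemma nonneg_eigenvector_pos:
  fixes F :: "real^'y^'y::finite"
  assumes sc: "strongly_connected_digraph E" and F: "F \<in> positive_edge_functions E"
    and ev: "F *v v = r *\<^sub>R v" and nn: "\<And>x. 0 \<le> v $ x" and "v \<noteq> 0"
  shows "0 < v $ x"
proof (rule ccontr)
  assume "\<not> 0 < v $ x"
  then have x: "x \<in> {x. v $ x = 0}" using nn[of x] by simp
  have step: "y \<in> {x. v $ x = 0}" if "x \<in> {x. v $ x = 0}" "(x, y) \<in> E" for x y
  proof -
    have "(\<Sum>y\<in>UNIV. F $ x $ y * v $ y) = r * v $ x"
      using ev by (simp add: vec_eq_iff matrix_vector_mult_def)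
    then have "(\<Sum>y\<in>UNIV. F $ x $ y * v $ y) = 0" using that by simp
    then have "F $ x $ y * v $ y = 0"
      by (subst (asm) sum_nonneg_eq_0_iff) (auto simp: nn positive_edge_functions_nonneg[OF F])
    moreover have "F $ x $ y > 0" using F that(2) by (auto simp: positive_edge_functions_def)
    ultimately show ?thesis by simp
  qed
  have "{x. v $ x = 0} = UNIV" using edge_closed_set_eq_UNIV[OF sc x] step by blast
  then have "v = 0" by (auto simp: vec_eq_iff)
  with \<open>v \<noteq> 0\<close> show False by simp
qed

definition prob_simplex :: "(real^'y::finite) set" where
  "prob_simplex = {v. (\<forall>x. 0 \<le> v $ x) \<and> (\<Sum>x\<in>UNIV. v $ x) = 1}"

lemma compact_prob_simplex: "compact (prob_simplex :: (real^'y::finite) set)"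
proof -
  have "closed (prob_simplex :: (real^'y) set)"
    unfolding prob_simplex_def
    by (intro closed_Collect_conj closed_Collect_all closed_Collect_le closed_Collect_eq
        continuous_intros)
  moreover have "prob_simplex \<subseteq> cbox (0 :: real^'y) 1"
  proof
    fix v :: "real^'y" assume v: "v \<in> prob_simplex"
    then have "v $ x \<le> (\<Sum>x\<in>UNIV. v $ x)" for x
      by (intro member_le_sum) (auto simp: prob_simplex_def)
    with v show "v \<in> cbox 0 1" by (auto simp: prob_simplex_def mem_box_cart)
  qed
  ultimately show ?thesis
    by (meson bounded_cbox bounded_subset compact_eq_bounded_closed)
qed

lemma convex_prob_simplex: "convex (prob_simplex :: (real^'y::finite) set)"
  unfolding convex_def prob_simplex_def
  by (auto simp: sum.distrib simp flip: sum_distrib_left)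

lemma prob_simplex_nonempty: "(prob_simplex :: (real^'y::finite) set) \<noteq> {}"
proof -
  have "(\<chi> x. 1 / real CARD('y)) \<in> (prob_simplex :: (real^'y) set)"
    by (simp add: prob_simplex_def)
  then show ?thesis by blast
qed

abbreviation entry_sum :: "real^'y::finite \<Rightarrow> real" where
  "entry_sum v \<equiv> \<Sum>x\<in>UNIV. v $ x"

lemma prob_simplex_nonzero: "v \<in> prob_simplex \<Longrightarrow> v \<noteq> 0"
  by (auto simp: prob_simplex_def)

lemma entry_sum_image_pos:
  fixes F :: "real^'y^'y::finite"
  assumes sc: "strongly_connected_digraph E" and "E \<noteq> {}" and F: "F \<in> positive_edge_functions E"
    and v: "v \<in> prob_simplex"
  shows "0 < entry_sum (F *v v)"
proof -
  have nn: "\<And>x. 0 \<le> v $ x" using v by (simp add: prob_simplex_def)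
  obtain y where y: "v $ y \<noteq> 0" using prob_simplex_nonzero[OF v] by (auto simp: vec_eq_iff)
  obtain x where x: "(x, y) \<in> E" using ex_incoming_edge[OF sc \<open>E \<noteq> {}\<close>] .
  have "0 < F $ x $ y * v $ y"
    using F x y nn[of y] by (auto simp: positive_edge_functions_def)
  also have "\<dots> \<le> (F *v v) $ x"
    unfolding matrix_vector_mult_def
    by (simp, rule member_le_sum) (auto simp: nn positive_edge_functions_nonneg[OF F])
  also have "\<dots> \<le> entry_sum (F *v v)"
    by (rule member_le_sum)
      (auto simp: matrix_vector_mult_def intro!: sum_nonneg mult_nonneg_nonneg nn
        positive_edge_functions_nonneg[OF F])
  finally show ?thesis .
qed

text \<open>
  Brouwer's fixed point theorem, applied to the map that multiplies a vector of the simplex by \<open>F\<close>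
  and then rescales to entry sum 1: a fixed point is a nonnegative eigenvector.
\<close>
lemma ex_positive_eigenvector:
  fixes F :: "real^'y^'y::finite"
  assumes sc: "strongly_connected_digraph E" and "E \<noteq> {}" and F: "F \<in> positive_edge_functions E"
  obtains r v where "0 < r" "\<And>x. 0 < v $ x" "F *v v = r *\<^sub>R v"
proof -
  define g where "g v = inverse (entry_sum (F *v v)) *\<^sub>R (F *v v)" for v
  have pos: "0 < entry_sum (F *v v)" if "v \<in> prob_simplex" for v
    using entry_sum_image_pos[OF sc \<open>E \<noteq> {}\<close> F that] .
  have "continuous_on prob_simplex g"
    unfolding g_def
    by (intro continuous_intros linear_continuous_on matrix_vector_mul_bounded_linear)
      (use pos in force)
  moreover have "g \<in> prob_simplex \<rightarrow> prob_simplex"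
  proof (rule Pi_I)
    fix v :: "real^'y" assume v: "v \<in> prob_simplex"
    have "0 \<le> (F *v v) $ x" for x
      using v positive_edge_functions_nonneg[OF F]
      by (auto simp: matrix_vector_mult_def prob_simplex_def intro!: sum_nonneg)
    then show "g v \<in> prob_simplex"
      using pos[OF v] by (auto simp: g_def prob_simplex_def simp flip: sum_distrib_left)
  qed
  ultimately obtain v where v: "v \<in> prob_simplex" and gv: "g v = v"
    using brouwer[OF compact_prob_simplex convex_prob_simplex prob_simplex_nonempty] by blast
  let ?r = "entry_sum (F *v v)"
  have ev: "F *v v = ?r *\<^sub>R v"
  proof -
    have "?r *\<^sub>R v = ?r *\<^sub>R g v" using gv by simp
    also have "\<dots> = F *v v" using pos[OF v] by (simp add: g_def del: sum_component)
    finally show ?thesis by simp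
  qed
  have "0 < v $ x" for x
    using nonneg_eigenvector_pos[OF sc F ev] v prob_simplex_nonzero[OF v]
    by (auto simp: prob_simplex_def)
  then show thesis using that pos[OF v] ev by blast
qed

text \<open>
  The positive eigenvector \<open>v\<close> acts as a weight: in the norm \<open>max\<^sub>x |w x| / v x\<close> the operator norm of
  a nonnegative matrix \<open>F\<close> with \<open>F v = r v\<close> is \<open>r\<close>.
\<close>
lemma eigenvalue_norm_le:
  fixes F :: "real^'y^'y::finite" and l :: complex
  assumes nn: "\<And>x y. 0 \<le> F $ x $ y" and v: "\<And>x. 0 < v $ x" and ev: "F *v v = r *\<^sub>R v"
    and l: "l \<in> complex_eigenvalues F"
  shows "cmod l \<le> r"
proof -
  obtain w :: "complex^'y" where w: "w \<noteq> 0"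
    and lw: "(\<chi> x y. complex_of_real (F $ x $ y)) *v w = l *s w"
    using l by (auto simp: complex_eigenvalues_def)
  define m where "m = (MAX x. cmod (w $ x) / v $ x)"
  have le: "cmod (w $ y) \<le> m * v $ y" for y
  proof -
    have "cmod (w $ y) / v $ y \<le> m" unfolding m_def by (rule Max_ge) auto
    then show ?thesis using v[of y] by (simp add: divide_le_eq)
  qed
  have "m \<in> range (\<lambda>x. cmod (w $ x) / v $ x)" unfolding m_def by (rule Max_in) auto
  then obtain x where "m = cmod (w $ x) / v $ x" by blast
  then have x: "cmod (w $ x) = m * v $ x" using v[of x] by simp
  have "m > 0"
  proof -
    obtain y where "w $ y \<noteq> 0" using w by (auto simp: vec_eq_iff)
    then have "0 < m * v $ y" using le[of y] by (meson less_le_trans zero_less_norm_iff)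
    then show ?thesis using v[of y] zero_less_mult_pos2 by blast
  qed
  \<comment> \<open>Compare both sides of the eigenvalue equation at a vertex \<open>x\<close> where the maximum is attained.\<close>
  have "cmod l * (m * v $ x) = cmod (\<Sum>y\<in>UNIV. complex_of_real (F $ x $ y) * w $ y)"
    using lw x by (auto simp: vec_eq_iff matrix_vector_mult_def norm_mult)
  also have "\<dots> \<le> (\<Sum>y\<in>UNIV. F $ x $ y * cmod (w $ y))"
    by (rule order_trans[OF norm_sum]) (simp add: norm_mult nn)
  also have "\<dots> \<le> (\<Sum>y\<in>UNIV. F $ x $ y * (m * v $ y))"
    by (intro sum_mono mult_left_mono le nn)
  also have "\<dots> = m * (\<Sum>y\<in>UNIV. F $ x $ y * v $ y)"
    by (simp add: sum_distrib_left mult_ac)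
  also have "(\<Sum>y\<in>UNIV. F $ x $ y * v $ y) = r * v $ x"
    using ev by (simp add: vec_eq_iff matrix_vector_mult_def)
  also have "m * (r * v $ x) = r * (m * v $ x)" by simp
  finally show ?thesis using \<open>m > 0\<close> v[of x] by simp
qed

lemma pf_root_eq:
  fixes F :: "real^'y^'y::finite"
  assumes nn: "\<And>x y. 0 \<le> F $ x $ y" and v: "\<And>x. 0 < v $ x" and ev: "F *v v = r *\<^sub>R v"
    and "0 \<le> r"
  shows "pf_root F = r"
proof -
  let ?w = "(\<chi> x. complex_of_real (v $ x)) :: complex^'y"
  have evx: "(\<Sum>y\<in>UNIV. F $ x $ y * v $ y) = r * v $ x" for x
    using ev by (simp add: vec_eq_iff matrix_vector_mult_def)
  have "?w \<noteq> 0" using v by (auto simp: vec_eq_iff) (metis less_irrefl)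
  moreover have "(\<chi> x y. complex_of_real (F $ x $ y)) *v ?w = complex_of_real r *s ?w"
    by (simp add: vec_eq_iff matrix_vector_mult_def evx flip: of_real_mult of_real_sum)
  ultimately have mem: "complex_of_real r \<in> complex_eigenvalues F"
    unfolding complex_eigenvalues_def by blast
  have r: "r \<in> cmod ` complex_eigenvalues F"
    using mem \<open>0 \<le> r\<close> by (intro image_eqI[of _ _ "complex_of_real r"]) auto
  show ?thesis
    unfolding pf_root_def
    by (rule cSup_eq_maximum[OF r]) (use eigenvalue_norm_le[OF nn v ev] in auto)
qed

text \<open>
  Subtract from \<open>w\<close> the largest multiple of \<open>v\<close> that stays below it. The difference is a nonnegative
  eigenvector with a zero entry, so it cannot be nonzero.
\<close>
lemma positive_eigenvector_unique:
  fixes F :: "real^'y^'y::finite"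
  assumes sc: "strongly_connected_digraph E" and F: "F \<in> positive_edge_functions E"
    and v: "\<And>x. 0 < v $ x" "F *v v = r *\<^sub>R v"
    and w: "\<And>x. 0 < w $ x" "F *v w = r *\<^sub>R w"
  obtains c where "w = c *\<^sub>R v"
proof -
  define c where "c = (MIN x. w $ x / v $ x)"
  have "c \<in> range (\<lambda>x. w $ x / v $ x)" unfolding c_def by (rule Min_in) auto
  then obtain x where "c = w $ x / v $ x" by blast
  then have x: "w $ x = c * v $ x" using v(1)[of x] by simp
  have le: "c * v $ y \<le> w $ y" for y
  proof -
    have "c \<le> w $ y / v $ y" unfolding c_def by (rule Min_le) auto
    then show ?thesis using v(1)[of y] by (simp add: le_divide_eq)
  qed
  have ev: "F *v (w - c *\<^sub>R v) = r *\<^sub>R (w - c *\<^sub>R v)"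
    using v(2) w(2)
    by (simp add: matrix_vector_mult_diff_distrib algebra_simps
        matrix_vector_mult_scaleR)
  have "w - c *\<^sub>R v = 0"
  proof (rule ccontr)
    assume "w - c *\<^sub>R v \<noteq> 0"
    from nonneg_eigenvector_pos[OF sc F ev _ this, of x] le x show False by simp
  qed
  then have "w = c *\<^sub>R v" by simp
  then show thesis by (rule that)
qed

section \<open>Rescaling to a stochastic matrix\<close>
lemma stochastic_matricesD:
  assumes "P \<in> stochastic_matrices E"
  shows "P \<in> positive_edge_functions E" "(\<Sum>y\<in>UNIV. P $ x $ y) = 1"
  using assms by (auto simp: stochastic_matrices_def)

lemma pf_vector_eigenvector:
  fixes F :: "real^'y^'y::finite"
  assumes sc: "strongly_connected_digraph E" and "E \<noteq> {}" and F: "F \<in> positive_edge_functions E"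
  shows "0 < pf_root F" "0 < pf_vector F $ x" "F *v pf_vector F = pf_root F *\<^sub>R pf_vector F"
proof -
  obtain r v where r: "0 < r" and v: "\<And>x. 0 < v $ x" and ev: "F *v v = r *\<^sub>R v"
    using ex_positive_eigenvector[OF assms] by blast
  have root: "pf_root F = r"
    using pf_root_eq[OF positive_edge_functions_nonneg[OF F] v ev] r by simp
  with r show "0 < pf_root F" by simp
  have "\<exists>v. (\<forall>y. v $ y > 0) \<and> F *v v = pf_root F *\<^sub>R v"
    using v ev root by blast
  from someI_ex[OF this]
  show "0 < pf_vector F $ x" "F *v pf_vector F = pf_root F *\<^sub>R pf_vector F"
    unfolding pf_vector_def by blast+
qed

lemma stoch_rescale_stochastic:
  fixes F :: "real^'y^'y::finite"
  assumes sc: "strongly_connected_digraph E" and ne: "E \<noteq> {}" and F: "F \<in> positive_edge_functions E"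
  shows "stoch_rescale F \<in> stochastic_matrices E"
proof -
  note pf = pf_vector_eigenvector[OF sc ne F]
  have "(\<Sum>y\<in>UNIV. stoch_rescale F $ x $ y) = 1" for x
  proof -
    have "(\<Sum>y\<in>UNIV. F $ x $ y * pf_vector F $ y) = pf_root F * pf_vector F $ x"
      using pf(3) by (simp add: vec_eq_iff matrix_vector_mult_def)
    then show ?thesis
      using pf(1) pf(2)[of x] by (simp add: stoch_rescale_def flip: sum_divide_distrib)
  qed
  moreover have "stoch_rescale F \<in> positive_edge_functions E"
    using F pf by (auto simp: stoch_rescale_def positive_edge_functions_def edge_functions_def)
  ultimately show ?thesis by (simp add: stochastic_matrices_def)
qed

text \<open>
  The logarithm turns the factor \<open>v y / (r v x)\<close> of the rescaling into
  \<open>ln (v y) - ln (v x) - ln r\<close>, which is of the form that defines the null functions.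
\<close>
lemma edge_ln_stoch_rescale:
  fixes F :: "real^'y^'y::finite"
  assumes sc: "strongly_connected_digraph E" and ne: "E \<noteq> {}" and F: "F \<in> positive_edge_functions E"
  shows "edge_ln E (stoch_rescale F) - edge_ln E F \<in> null_functions E"
proof -
  note pf = pf_vector_eigenvector[OF sc ne F]
  have "(edge_ln E (stoch_rescale F) - edge_ln E F) $ x $ y
      = ln (pf_vector F $ y) - ln (pf_vector F $ x) + - ln (pf_root F)" if "(x, y) \<in> E" for x y
  proof -
    have "0 < F $ x $ y" using F that by (auto simp: positive_edge_functions_def)
    then show ?thesis
      using that pf(1) pf(2)[of x] pf(2)[of y]
      by (simp add: edge_ln_def stoch_rescale_def ln_div ln_mult)
  qed
  moreover have "edge_ln E (stoch_rescale F) - edge_ln E F \<in> edge_functions E"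
    by (simp add: edge_ln_def edge_functions_def)
  ultimately show ?thesis unfolding null_functions_def
    by (intro CollectI conjI exI[of _ "\<lambda>x. ln (pf_vector F $ x)"] exI[of _ "- ln (pf_root F)"]) auto
qed

text \<open>
  If \<open>ln P - ln P'\<close> is given by \<open>f\<close> and \<open>c\<close>, then the row sums of \<open>P\<close> being 1 say that \<open>exp f\<close> is a
  positive eigenvector of \<open>P'\<close> for the eigenvalue \<open>exp (- c)\<close>. The constant vector is another one,
  for the eigenvalue 1. Uniqueness of the Perron--Frobenius data forces \<open>c = 0\<close> and \<open>f\<close> constant.
\<close>
lemma stochastic_eq_if_edge_ln_cong:
  fixes P :: "real^'y^'y::finite"
  assumes sc: "strongly_connected_digraph E"
    and P: "P \<in> stochastic_matrices E" and P': "P' \<in> stochastic_matrices E"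
    and N: "edge_ln E P - edge_ln E P' \<in> null_functions E"
  shows "P = P'"
proof -
  obtain f c where "\<forall>(x, y) \<in> E. (edge_ln E P - edge_ln E P') $ x $ y = f y - f x + c"
    using N unfolding null_functions_def by blast
  then have fc: "\<And>x y. (x, y) \<in> E \<Longrightarrow> (edge_ln E P - edge_ln E P') $ x $ y = f y - f x + c"
    by blast
  note posP = stochastic_matricesD(1)[OF P] and posP' = stochastic_matricesD(1)[OF P']
  have eq: "P $ x $ y = P' $ x $ y * exp (f y - f x + c)" for x y
  proof (cases "(x, y) \<in> E")
    case True
    then have pos: "0 < P $ x $ y" "0 < P' $ x $ y"
      using posP posP' by (auto simp: positive_edge_functions_def)
    have "ln (P $ x $ y) = ln (P' $ x $ y) + (f y - f x + c)"
      using fc[OF True] True by (simp add: edge_ln_def)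
    then have "exp (ln (P $ x $ y)) = exp (ln (P' $ x $ y)) * exp (f y - f x + c)"
      by (simp only: exp_add)
    then show ?thesis using pos by simp
  next
    case False
    then show ?thesis
      using posP posP' by (auto simp: positive_edge_functions_def edge_functions_def)
  qed
  define v :: "real^'y" where "v = (\<chi> x. exp (f x))"
  have vpos: "0 < v $ x" for x by (simp add: v_def)
  have ev: "P' *v v = exp (- c) *\<^sub>R v"
  proof -
    have "(\<Sum>y\<in>UNIV. P' $ x $ y * exp (f y)) = exp (- c) * exp (f x)" for x
    proof -
      have "(\<Sum>y\<in>UNIV. P' $ x $ y * exp (f y)) =
          (\<Sum>y\<in>UNIV. exp (- c) * exp (f x) * P $ x $ y)"
        by (intro sum.cong refl) (simp add: eq exp_add exp_diff exp_minus field_simps)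
      also have "\<dots> = exp (- c) * exp (f x)"
        by (simp only: stochastic_matricesD(2)[OF P] mult_1_right flip: sum_distrib_left)
      finally show ?thesis .
    qed
    then show ?thesis by (simp add: vec_eq_iff matrix_vector_mult_def v_def)
  qed
  have one: "P' *v 1 = 1 *\<^sub>R 1"
    using stochastic_matricesD(2)[OF P'] by (simp add: vec_eq_iff matrix_vector_mult_def)
  have "pf_root P' = exp (- c)"
    using pf_root_eq[OF positive_edge_functions_nonneg[OF posP'] vpos ev] by simp
  moreover have "pf_root P' = 1"
    using pf_root_eq[OF positive_edge_functions_nonneg[OF posP'] _ one] by simp
  ultimately have c: "exp (- c) = 1" by simp
  obtain k where k: "v = k *\<^sub>R 1"
    by (rule positive_eigenvector_unique[OF sc posP' _ one vpos]) (use ev c in auto)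
  have "exp (f x) = k" for x
    using arg_cong[OF k, of "\<lambda>w. w $ x"] by (simp add: v_def)
  then have "f x = ln k" for x by (metis ln_exp)
  then show ?thesis using eq c by (simp add: vec_eq_iff)
qed


lemma simplex_eigenvector_unique:
  fixes F :: "real^'y^'y::finite"
  assumes sc: "strongly_connected_digraph E" and ne: "E \<noteq> {}" and F: "F \<in> positive_edge_functions E"
    and v: "v \<in> prob_simplex" "F *v v = entry_sum (F *v v) *\<^sub>R v"
    and w: "w \<in> prob_simplex" "F *v w = entry_sum (F *v w) *\<^sub>R w"
  shows "v = w"
proof -
  have pos: "0 < u $ x" if "u \<in> prob_simplex" "F *v u = entry_sum (F *v u) *\<^sub>R u" for u x
    using nonneg_eigenvector_pos[OF sc F that(2)] that(1) prob_simplex_nonzero[OF that(1)]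
    by (auto simp: prob_simplex_def)
  have root: "entry_sum (F *v u) = pf_root F"
    if "u \<in> prob_simplex" "F *v u = entry_sum (F *v u) *\<^sub>R u" for u
    using pf_root_eq[OF positive_edge_functions_nonneg[OF F] pos[OF that] that(2)]
      entry_sum_image_pos[OF sc ne F that(1)] by simp
  obtain c where c: "w = c *\<^sub>R v"
    using positive_eigenvector_unique[OF sc F pos[OF v] _ pos[OF w]] v(2) w(2) root[OF v] root[OF w]
    by metis
  have "entry_sum w = c * entry_sum v" by (simp add: c sum_distrib_left)
  then have "c = 1" using v(1) w(1) by (simp add: prob_simplex_def)
  with c show ?thesis by simp
qed

text \<open>
  The chosen eigenvector \<open>pf_vector F\<close> need not depend continuously on \<open>F\<close>, since its scaling is
  arbitrary. Normalising its entry sum makes it the unique solution of an equation in a compact set.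
\<close>
definition perron_vector :: "real^'y^'y::finite \<Rightarrow> real^'y" where
  "perron_vector F = inverse (entry_sum (pf_vector F)) *\<^sub>R pf_vector F"

lemma perron_vector:
  fixes F :: "real^'y^'y::finite"
  assumes sc: "strongly_connected_digraph E" and ne: "E \<noteq> {}" and F: "F \<in> positive_edge_functions E"
  shows "perron_vector F \<in> prob_simplex" "0 < perron_vector F $ x"
    "F *v perron_vector F = entry_sum (F *v perron_vector F) *\<^sub>R perron_vector F"
    "stoch_rescale F $ x $ y =
      F $ x $ y * perron_vector F $ y / (entry_sum (F *v perron_vector F) * perron_vector F $ x)"
proof -
  note pf = pf_vector_eigenvector[OF sc ne F]
  have pos: "0 < entry_sum (pf_vector F)" by (rule sum_pos) (use pf(2) in auto)
  show 1: "perron_vector F \<in> prob_simplex"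
    using pos pf(2)
    by (auto simp: perron_vector_def prob_simplex_def less_imp_le simp flip: sum_distrib_left)
  show 2: "0 < perron_vector F $ x" using pos pf(2)[of x] by (simp add: perron_vector_def)
  have ev: "F *v perron_vector F = pf_root F *\<^sub>R perron_vector F"
    by (simp add: perron_vector_def matrix_vector_mult_scaleR pf(3))
  have es: "entry_sum (F *v perron_vector F) = pf_root F"
    using 1 by (simp add: ev prob_simplex_def flip: sum_distrib_left)
  show "F *v perron_vector F = entry_sum (F *v perron_vector F) *\<^sub>R perron_vector F"
    using ev es by simp
  show "stoch_rescale F $ x $ y =
      F $ x $ y * perron_vector F $ y / (entry_sum (F *v perron_vector F) * perron_vector F $ x)"
    unfolding es using pos pf(1) pf(2)[of x]
    by (simp add: stoch_rescale_def perron_vector_def field_simps)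
qed

text \<open>
  A map into a compact set is continuous if its graph is closed. The graph is cut out of the
  product by the continuous equation \<open>F v = entry_sum (F v) v\<close>, because the normalised
  eigenvector is the only solution in the simplex.
\<close>
lemma continuous_on_perron_vector:
  assumes sc: "strongly_connected_digraph E" and ne: "E \<noteq> {}"
  shows "continuous_on (positive_edge_functions E) perron_vector"
proof -
  let ?S = "positive_edge_functions E" and ?T = "prob_simplex :: (real^'a) set"
  let ?h = "\<lambda>z :: (real^'a^'a) \<times> (real^'a).
      fst z *v snd z - entry_sum (fst z *v snd z) *\<^sub>R snd z"
  have "(\<lambda>F. (F, perron_vector F)) ` ?S = ?S \<times> ?T \<inter> ?h -` {0}"
  proof (intro equalityI subsetI)
    fix z assume "z \<in> (\<lambda>F. (F, perron_vector F)) ` ?S"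
    then obtain F where F: "F \<in> ?S" and z: "z = (F, perron_vector F)" by blast
    have "?h z = 0"
      unfolding z fst_conv snd_conv right_minus_eq by (rule perron_vector(3)[OF sc ne F])
    then show "z \<in> ?S \<times> ?T \<inter> ?h -` {0}"
      using F perron_vector(1)[OF sc ne F] by (simp only: z Int_iff mem_Sigma_iff vimage_singleton_eq)
  next
    fix z assume "z \<in> ?S \<times> ?T \<inter> ?h -` {0}"
    then obtain F v where z: "z = (F, v)" and F: "F \<in> ?S" and v: "v \<in> ?T" and "?h (F, v) = 0"
      by blast
    then have "F *v v = entry_sum (F *v v) *\<^sub>R v" by (simp only: fst_conv snd_conv right_minus_eq)
    then have "v = perron_vector F"
      by (intro simplex_eigenvector_unique[OF sc ne F v] perron_vector(1,3)[OF sc ne F])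
    with F show "z \<in> (\<lambda>F. (F, perron_vector F)) ` ?S" unfolding z by blast
  qed
  moreover have "continuous_on (?S \<times> ?T) ?h"
    unfolding matrix_vector_mult_def by (intro continuous_intros)
  ultimately have "closedin (top_of_set (?S \<times> ?T)) ((\<lambda>F. (F, perron_vector F)) ` ?S)"
    by (simp only: continuous_closedin_preimage closed_singleton)
  moreover have "perron_vector \<in> ?S \<rightarrow> ?T" using perron_vector(1)[OF sc ne] by auto
  ultimately show ?thesis using continuous_closed_graph_eq[OF compact_prob_simplex] by blast
qed

lemma continuous_on_stoch_rescale:
  assumes sc: "strongly_connected_digraph E" and ne: "E \<noteq> {}"
  shows "continuous_on (positive_edge_functions E) stoch_rescale"
proof -
  let ?g = "\<lambda>F :: real^'a^'a. \<chi> x y. F $ x $ y * perron_vector F $ y /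
      (entry_sum (F *v perron_vector F) * perron_vector F $ x)"
  have nz: "entry_sum (F *v perron_vector F) * perron_vector F $ x \<noteq> 0"
    if "F \<in> positive_edge_functions E" for F x
    using entry_sum_image_pos[OF sc ne that perron_vector(1)[OF sc ne that]]
      perron_vector(2)[OF sc ne that, of x] by simp
  have "continuous_on (positive_edge_functions E) ?g"
    unfolding matrix_vector_mult_def
    by (intro continuous_intros continuous_on_perron_vector[OF sc ne])
      (use nz in \<open>simp add: matrix_vector_mult_def\<close>)
  then show ?thesis
    by (rule continuous_on_eq) (simp add: vec_eq_iff perron_vector(4)[OF sc ne])
qed

section \<open>Logarithmic coordinates\<close>
lemma subspace_edge_functions: "subspace (edge_functions E)"
  by (auto simp: edge_functions_def subspace_def)

lemma subspace_null_functions: "subspace (null_functions E)"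
  unfolding subspace_def
proof (intro conjI ballI allI)
  show "0 \<in> null_functions E"
    unfolding null_functions_def
    using subspace_0[OF subspace_edge_functions]
    by (auto intro!: exI[of _ "\<lambda>_. 0"] exI[of _ 0])
next
  fix M N assume "M \<in> null_functions E" "N \<in> null_functions E"
  then obtain f c g d where
    M: "M \<in> edge_functions E" "\<forall>(x, y) \<in> E. M $ x $ y = f y - f x + c" and
    N: "N \<in> edge_functions E" "\<forall>(x, y) \<in> E. N $ x $ y = g y - g x + d"
    unfolding null_functions_def by auto
  show "M + N \<in> null_functions E"
    unfolding null_functions_def
  proof (intro CollectI conjI exI)
    show "M + N \<in> edge_functions E"
      using M(1) N(1) by (rule subspace_add[OF subspace_edge_functions])
    show "\<forall>(x, y) \<in> E. (M + N) $ x $ y = (f y + g y) - (f x + g x) + (c + d)"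
      using M(2) N(2) by (fastforce simp: algebra_simps)
  qed
next
  fix a N assume "N \<in> null_functions E"
  then obtain g d where
    N: "N \<in> edge_functions E" "\<forall>(x, y) \<in> E. N $ x $ y = g y - g x + d"
    unfolding null_functions_def by auto
  show "a *\<^sub>R N \<in> null_functions E"
    unfolding null_functions_def
  proof (intro CollectI conjI exI)
    show "a *\<^sub>R N \<in> edge_functions E"
      using N(1) by (rule subspace_scale[OF subspace_edge_functions])
    show "\<forall>(x, y) \<in> E. (a *\<^sub>R N) $ x $ y = a * g y - a * g x + a * d"
    proof clarify
      fix x y assume "(x, y) \<in> E"
      then have "N $ x $ y = g y - g x + d" using N(2) by blast
      then show "(a *\<^sub>R N) $ x $ y = a * g y - a * g x + a * d"
        by (simp add: distrib_left right_diff_distrib)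
    qed
  qed
qed

lemma null_functions_subset: "null_functions E \<subseteq> edge_functions E"
  by (auto simp: null_functions_def)

lemma ex_linear_projection_along_subspace:
  fixes N :: "'a::euclidean_space set"
  assumes "subspace N"
  shows "\<exists>p :: 'a \<Rightarrow> 'a. linear p \<and> (\<forall>x. p x - x \<in> N) \<and> (\<forall>x\<in>N. p x = 0)"
proof -
  obtain B where "B \<subseteq> N" and B: "pairwise orthogonal B" "\<And>x. x \<in> B \<Longrightarrow> norm x = 1"
    "independent B" "span B = N"
    using orthonormal_basis_subspace[OF assms] by metis
  have finB: "finite B" using B(3) by (simp add: independent_imp_finite)
  define p where "p x = x - (\<Sum>b\<in>B. (x \<bullet> b) *\<^sub>R b)" for x
  have lin: "linear p"
    unfolding p_def
    by (intro linearI)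
      (simp_all add: inner_add_left scaleR_add_left sum.distrib scaleR_diff_right scaleR_sum_right)
  have pB: "p b = 0" if "b \<in> B" for b
  proof -
    have "(\<Sum>a\<in>B. (b \<bullet> a) *\<^sub>R a) = (\<Sum>a\<in>B. if a = b then b else 0)"
    proof (rule sum.cong[OF refl])
      fix a assume "a \<in> B"
      then show "(b \<bullet> a) *\<^sub>R a = (if a = b then b else 0)"
        using B(1) B(2)[OF that] that
        by (auto simp: pairwise_def orthogonal_def dot_square_norm)
    qed
    then show ?thesis using finB that by (simp add: p_def)
  qed
  have "p x = 0" if "x \<in> N" for x
    using linear_eq_on_span[OF lin linear_zero, of B] pB that B(4) by blast
  moreover have "p x - x \<in> N" for x
    unfolding p_def using \<open>B \<subseteq> N\<close> assms
    by (auto intro!: subspace_sum subspace_scale subspace_neg)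
  ultimately show ?thesis using lin by blast
qed

text \<open>
  The quotient of the edge functions by the null functions is realised as a linear subspace of the
  matrix space, the range of a linear projection that kills exactly the null functions. Subspaces of
  a Euclidean space have the affine hulls, dimensions and topology that the argument needs.
\<close>
definition mod_null :: "('y::finite \<times> 'y) set \<Rightarrow> real^'y^'y \<Rightarrow> real^'y^'y" where
  "mod_null E = (SOME p. linear p \<and> (\<forall>F. p F - F \<in> null_functions E) \<and>
     (\<forall>N\<in>null_functions E. p N = 0))"

lemma mod_null:
  shows linear_mod_null: "linear (mod_null E)"
    and mod_null_diff: "mod_null E F - F \<in> null_functions E"
    and mod_null_eq_0: "N \<in> null_functions E \<Longrightarrow> mod_null E N = 0"
  using someI_ex[OF ex_linear_projection_along_subspace[OF subspace_null_functions[of E]],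
      folded mod_null_def] by auto

lemma mod_null_eq_iff: "mod_null E F = mod_null E G \<longleftrightarrow> F - G \<in> null_functions E"
proof
  assume "F - G \<in> null_functions E"
  then show "mod_null E F = mod_null E G"
    using mod_null_eq_0[of "F - G" E] by (simp add: linear_diff[OF linear_mod_null])
next
  assume eq: "mod_null E F = mod_null E G"
  have "(mod_null E G - G) - (mod_null E F - F) \<in> null_functions E"
    by (intro subspace_diff[OF subspace_null_functions] mod_null_diff)
  then show "F - G \<in> null_functions E" by (simp add: eq)
qed

lemma mod_null_idem: "mod_null E (mod_null E F) = mod_null E F"
  by (simp add: mod_null_eq_iff mod_null_diff)

lemma mod_null_in_edge_functions:
  "F \<in> edge_functions E \<Longrightarrow> mod_null E F \<in> edge_functions E"
  using subspace_add[OF subspace_edge_functions, of "mod_null E F - F" E F]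
    mod_null_diff[of E F] null_functions_subset by auto

text \<open>
  The maps \<open>log_class E\<close> and \<open>stoch_exp E\<close> are mutually inverse homeomorphisms between the stochastic
  matrices and the range of \<open>mod_null E\<close> on edge functions: they are the global chart in which
  e-families become affine subspaces.
\<close>
definition log_class :: "('y::finite \<times> 'y) set \<Rightarrow> real^'y^'y \<Rightarrow> real^'y^'y" where
  "log_class E Q = mod_null E (edge_ln E Q)"

definition stoch_exp :: "('y::finite \<times> 'y) set \<Rightarrow> real^'y^'y \<Rightarrow> real^'y^'y" where
  "stoch_exp E F = stoch_rescale (edge_exp E F)"

lemma edge_exp_positive: "edge_exp E F \<in> positive_edge_functions E"
  by (auto simp: edge_exp_def positive_edge_functions_def edge_functions_def)

lemma edge_ln_in_edge_functions: "edge_ln E F \<in> edge_functions E"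
  by (auto simp: edge_ln_def edge_functions_def)

lemma edge_ln_edge_exp: "F \<in> edge_functions E \<Longrightarrow> edge_ln E (edge_exp E F) = F"
  by (auto simp: edge_exp_def edge_ln_def edge_functions_def vec_eq_iff)

lemma edge_exp_edge_ln: "Q \<in> positive_edge_functions E \<Longrightarrow> edge_exp E (edge_ln E Q) = Q"
  by (auto simp: edge_exp_def edge_ln_def positive_edge_functions_def edge_functions_def vec_eq_iff)

lemma log_class_in_edge_functions: "log_class E Q \<in> edge_functions E"
  unfolding log_class_def by (intro mod_null_in_edge_functions edge_ln_in_edge_functions)

lemma mod_null_log_class: "mod_null E (log_class E Q) = log_class E Q"
  by (simp add: log_class_def mod_null_idem)

lemma continuous_on_log_class: "continuous_on (positive_edge_functions E) (log_class E)"
proof -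
  have "continuous_on (positive_edge_functions E) (edge_ln E)"
    unfolding edge_ln_def
  proof (intro continuous_on_vec_lambda)
    fix x y
    show "continuous_on (positive_edge_functions E) (\<lambda>F. if (x, y) \<in> E then ln (F $ x $ y) else 0)"
      by (cases "(x, y) \<in> E")
        (auto intro!: continuous_intros simp: positive_edge_functions_def)
  qed
  then show ?thesis
    unfolding log_class_def
    by (intro linear_continuous_on_compose[OF _ linear_mod_null])
qed

lemma continuous_on_stoch_exp:
  assumes "strongly_connected_digraph E" and "E \<noteq> {}"
  shows "continuous_on A (stoch_exp E)"
proof -
  have "continuous_on A (edge_exp E)"
    unfolding edge_exp_def
  proof (intro continuous_on_vec_lambda)
    fix x y
    show "continuous_on A (\<lambda>F. if (x, y) \<in> E then exp (F $ x $ y) else 0)"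
      by (cases "(x, y) \<in> E") (auto intro!: continuous_intros)
  qed
  then show ?thesis
    unfolding stoch_exp_def
    by (rule continuous_on_compose2[OF continuous_on_stoch_rescale[OF assms]])
      (use edge_exp_positive in auto)
qed

lemma log_class_stoch_rescale:
  assumes "strongly_connected_digraph E" and "E \<noteq> {}" and "F \<in> positive_edge_functions E"
  shows "log_class E (stoch_rescale F) = log_class E F"
  unfolding log_class_def mod_null_eq_iff using edge_ln_stoch_rescale[OF assms] .

lemma inj_on_log_class:
  assumes "strongly_connected_digraph E"
  shows "inj_on (log_class E) (stochastic_matrices E)"
  unfolding inj_on_def log_class_def mod_null_eq_iff
  using stochastic_eq_if_edge_ln_cong[OF assms] by blast

lemma stoch_exp_stochastic:
  assumes "strongly_connected_digraph E" and "E \<noteq> {}"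
  shows "stoch_exp E F \<in> stochastic_matrices E"
  unfolding stoch_exp_def by (intro stoch_rescale_stochastic assms edge_exp_positive)

lemma log_class_stoch_exp:
  assumes "strongly_connected_digraph E" and "E \<noteq> {}" and "F \<in> edge_functions E"
  shows "log_class E (stoch_exp E F) = mod_null E F"
  unfolding stoch_exp_def log_class_stoch_rescale[OF assms(1,2) edge_exp_positive]
  by (simp add: log_class_def edge_ln_edge_exp assms(3))

lemma stoch_exp_mod_null:
  assumes "strongly_connected_digraph E" and "E \<noteq> {}" and "F \<in> edge_functions E"
  shows "stoch_exp E (mod_null E F) = stoch_exp E F"
  by (rule inj_onD[OF inj_on_log_class[OF assms(1)]])
    (use assms in \<open>simp_all add: stoch_exp_stochastic log_class_stoch_exp mod_null_idem
      mod_null_in_edge_functions\<close>)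

lemma stoch_exp_log_class:
  assumes "strongly_connected_digraph E" and "E \<noteq> {}" and "P \<in> stochastic_matrices E"
  shows "stoch_exp E (log_class E P) = P"
  by (rule inj_onD[OF inj_on_log_class[OF assms(1)]])
    (use assms in \<open>simp_all add: stoch_exp_stochastic log_class_stoch_exp
      log_class_in_edge_functions mod_null_log_class\<close>)

section \<open>E-families as affine subspaces\<close>
text \<open>
  Linear independence of a family indexed by numbers, in which repetitions are possible a priori,
  is translated to independence of its set of values.
\<close>
lemma independent_family:
  fixes G :: "nat \<Rightarrow> 'a::euclidean_space"
  assumes indep: "\<And>a :: nat \<Rightarrow> real. (\<Sum>i<n. a i *\<^sub>R G i) = 0 \<Longrightarrow> \<forall>i<n. a i = 0"
  shows "inj_on G {..<n}" "independent (G ` {..<n})"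
proof -
  show inj: "inj_on G {..<n}"
  proof (rule inj_onI, rule ccontr)
    fix i j assume ij: "i \<in> {..<n}" "j \<in> {..<n}" "G i = G j" "i \<noteq> j"
    define a :: "nat \<Rightarrow> real" where "a k = (if k = i then 1 else 0) - (if k = j then 1 else 0)" for k
    have "(\<Sum>k<n. a k *\<^sub>R G k)
        = (\<Sum>k<n. (if k = i then G k else 0) - (if k = j then G k else 0))"
      by (rule sum.cong) (auto simp: a_def)
    also have "\<dots> = 0" using ij by (simp add: sum_subtractf)
    finally have "a i = 0" using indep[of a] ij by auto
    then show False using ij by (simp add: a_def)
  qed
  show "independent (G ` {..<n})"
  proof (rule independent_if_scalars_zero)
    fix u x assume s: "(\<Sum>x\<in>G ` {..<n}. u x *\<^sub>R x) = 0" and x: "x \<in> G ` {..<n}"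
    have "(\<Sum>i<n. u (G i) *\<^sub>R G i) = 0" using s by (simp add: sum.reindex[OF inj])
    from indep[OF this] x show "u x = 0" by auto
  qed simp
qed

lemma span_family:
  fixes G :: "nat \<Rightarrow> 'a::euclidean_space"
  assumes "inj_on G {..<n}"
  shows "span (G ` {..<n}) = range (\<lambda>\<theta> :: nat \<Rightarrow> real. \<Sum>i<n. \<theta> i *\<^sub>R G i)"
proof (intro equalityI subsetI)
  fix x assume "x \<in> span (G ` {..<n})"
  then obtain u where "x = (\<Sum>v\<in>G ` {..<n}. u v *\<^sub>R v)" by (auto simp: span_finite)
  then have "x = (\<Sum>i<n. u (G i) *\<^sub>R G i)" by (simp add: sum.reindex[OF assms])
  then show "x \<in> range (\<lambda>\<theta> :: nat \<Rightarrow> real. \<Sum>i<n. \<theta> i *\<^sub>R G i)"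
    by (intro range_eqI[of _ _ "\<lambda>i. u (G i)"])
next
  fix x assume "x \<in> range (\<lambda>\<theta> :: nat \<Rightarrow> real. \<Sum>i<n. \<theta> i *\<^sub>R G i)"
  then show "x \<in> span (G ` {..<n})" by clarify (intro span_sum span_scale span_base; simp)
qed

text \<open>
  In logarithmic coordinates an e-family is a translate of the span of the classes of its generators,
  which are linearly independent. So its dimension is determined by the set alone.
\<close>
lemma e_family_aff_dim_log_class:
  assumes sc: "strongly_connected_digraph E" and ne: "E \<noteq> {}" and fam: "e_family E n X"
  shows "aff_dim (log_class E ` X) = int n"
proof -
  obtain K G where K: "K \<in> edge_functions E" and G: "\<And>i. i < n \<Longrightarrow> G i \<in> edge_functions E"
    and indep: "\<And>a :: nat \<Rightarrow> real. (\<Sum>i<n. a i *\<^sub>R G i) \<in> null_functions E \<Longrightarrow> \<forall>i<n. a i = 0"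
    and X: "X = range (\<lambda>\<theta> :: nat \<Rightarrow> real. stoch_exp E (K + (\<Sum>i<n. \<theta> i *\<^sub>R G i)))"
    using fam unfolding e_family_def stoch_exp_def full_SetCompr_eq by auto
  define H where "H i = mod_null E (G i)" for i
  have H_sum: "mod_null E (\<Sum>i<n. a i *\<^sub>R G i) = (\<Sum>i<n. a i *\<^sub>R H i)" for a
    by (simp add: H_def linear_sum[OF linear_mod_null] linear_scale[OF linear_mod_null])
  have H0: "\<forall>i<n. a i = 0" if "(\<Sum>i<n. a i *\<^sub>R H i) = 0" for a :: "nat \<Rightarrow> real"
  proof (rule indep)
    have "mod_null E (\<Sum>i<n. a i *\<^sub>R G i) = mod_null E 0"
      using that by (simp add: H_sum linear_0[OF linear_mod_null])
    then show "(\<Sum>i<n. a i *\<^sub>R G i) \<in> null_functions E" by (simp add: mod_null_eq_iff)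
  qed
  note indepH = independent_family[where G = H and n = n, OF H0]
  have "log_class E (stoch_exp E (K + (\<Sum>i<n. \<theta> i *\<^sub>R G i)))
      = mod_null E K + (\<Sum>i<n. \<theta> i *\<^sub>R H i)" for \<theta>
  proof -
    have "K + (\<Sum>i<n. \<theta> i *\<^sub>R G i) \<in> edge_functions E"
      using K G subspace_edge_functions
      by (intro subspace_add[OF subspace_edge_functions] subspace_sum subspace_scale) auto
    then show ?thesis
      by (simp add: log_class_stoch_exp[OF sc ne] linear_add[OF linear_mod_null] H_sum)
  qed
  then have "log_class E ` X = range (\<lambda>\<theta>. mod_null E K + (\<Sum>i<n. \<theta> i *\<^sub>R H i))"
    unfolding X by (simp only: image_image)
  also have "\<dots> = (+) (mod_null E K) ` span (H ` {..<n})"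
    by (simp only: span_family[OF indepH(1)] image_image)
  finally have "log_class E ` X = (+) (mod_null E K) ` span (H ` {..<n})" .
  then have "aff_dim (log_class E ` X) = int (dim (H ` {..<n}))"
    by (simp add: aff_dim_translation_eq aff_dim_subspace)
  also have "dim (H ` {..<n}) = n"
    using indepH by (simp add: dim_eq_card_independent card_image)
  finally show ?thesis .
qed

text \<open>
  The generators are a basis of the direction space of \<open>B\<close>. They are independent modulo the null
  functions because \<open>mod_null E\<close> fixes the direction space and kills the null functions.
\<close>
lemma e_family_stoch_exp_affine:
  assumes sc: "strongly_connected_digraph E" and ne: "E \<noteq> {}"
    and B: "affine B" "b \<in> B" "B \<subseteq> edge_functions E" and inv: "\<And>F. F \<in> B \<Longrightarrow> mod_null E F = F"
  shows "e_family E (nat (aff_dim B)) (stoch_exp E ` B)"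
proof -
  define L where "L = (\<lambda>x. x - b) ` B"
  have L: "subspace L" unfolding L_def using affine_diffs_subspace_subtract[OF B(1,2)] .
  have BL: "B = (+) b ` L" by (simp add: L_def image_image)
  have dimL: "nat (aff_dim B) = dim L"
    using aff_dim_translation_eq[of b L] aff_dim_subspace[OF L] by (simp add: BL)
  obtain A where A: "A \<subseteq> L" "independent A" "L \<subseteq> span A" "card A = dim L"
    by (rule basis_exists)
  have spanA: "span A = L" using A(1,3) L by (simp add: span_minimal subset_antisym)
  have finA: "finite A" using A(2) by (simp add: independent_imp_finite)
  obtain G where G: "bij_betw G {..<dim L} A"
    using ex_bij_betw_nat_finite[OF finA] A(4) by (auto simp: atLeast0LessThan)
  have GA: "G ` {..<dim L} = A" and injG: "inj_on G {..<dim L}"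
    using G by (auto simp: bij_betw_def)
  have L_edge: "x \<in> edge_functions E" if "x \<in> L" for x
    using that B(2,3) unfolding L_def by (auto intro!: subspace_diff[OF subspace_edge_functions])
  have L_fix: "mod_null E x = x" if "x \<in> L" for x
    using that inv B(2) unfolding L_def by (auto simp: linear_diff[OF linear_mod_null])
  show ?thesis
    unfolding e_family_def dimL
  proof (intro conjI bexI[of _ b] exI[of _ G] allI impI)
    show "stoch_exp E ` B \<subseteq> stochastic_matrices E"
      using stoch_exp_stochastic[OF sc ne] by auto
    show "b \<in> edge_functions E" using B by auto
    show "G i \<in> edge_functions E" if "i < dim L" for i
      using that GA A(1) by (intro L_edge) auto
    \<comment> \<open>A combination in the null functions is both fixed and killed by the projection.\<close>
    show "a i = 0" if null: "(\<Sum>i<dim L. a i *\<^sub>R G i) \<in> null_functions E" and i: "i < dim L" for a i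
    proof -
      have "(\<Sum>i<dim L. a i *\<^sub>R G i) \<in> L"
        using GA A(1) by (intro subspace_sum[OF L] subspace_scale[OF L]) auto
      from L_fix[OF this] have 0: "(\<Sum>i<dim L. a i *\<^sub>R G i) = 0"
        using mod_null_eq_0[OF null] by simp
      have "(\<Sum>v\<in>A. a (inv_into {..<dim L} G v) *\<^sub>R v) = (\<Sum>i<dim L. a i *\<^sub>R G i)"
        unfolding GA[symmetric] by (simp add: sum.reindex[OF injG] injG)
      then have "a (inv_into {..<dim L} G (G i)) = 0"
        using GA i by (intro independentD[OF A(2) finA order_refl]) (simp_all add: 0, blast)
      then show ?thesis using injG i by simp
    qed
    have "L = range (\<lambda>\<theta> :: nat \<Rightarrow> real. \<Sum>i<dim L. \<theta> i *\<^sub>R G i)"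
      using span_family[OF injG] by (simp only: GA spanA)
    then have "(+) b ` L = (+) b ` range (\<lambda>\<theta> :: nat \<Rightarrow> real. \<Sum>i<dim L. \<theta> i *\<^sub>R G i)"
      by (rule arg_cong)
    then have "B = (\<lambda>\<theta> :: nat \<Rightarrow> real. b + (\<Sum>i<dim L. \<theta> i *\<^sub>R G i)) ` UNIV"
      unfolding BL[symmetric] image_image .
    then show "stoch_exp E ` B
        = {stoch_rescale (edge_exp E (b + (\<Sum>i<dim L. \<theta> i *\<^sub>R G i))) | \<theta> :: nat \<Rightarrow> real. True}"
      by (auto simp: stoch_exp_def)
  qed
qed

text \<open>
  The form in which affine combinations occur in the e-hull, where points may be repeated.
\<close>
lemma affine_hull_iff_nat_indexed:
  fixes S :: "'a::real_vector set"
  shows "x \<in> affine hull S \<longleftrightarrow> (\<exists>(k :: nat) (\<alpha> :: nat \<Rightarrow> real) p.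
    (\<forall>i<k. p i \<in> S) \<and> (\<Sum>i<k. \<alpha> i) = 1 \<and> x = (\<Sum>i<k. \<alpha> i *\<^sub>R p i))"
proof
  assume "x \<in> affine hull S"
  then obtain T u where T: "finite T" "T \<subseteq> S" "sum u T = 1" "(\<Sum>v\<in>T. u v *\<^sub>R v) = x"
    unfolding affine_hull_explicit by auto
  obtain p where p: "bij_betw p {..<card T} T"
    using ex_bij_betw_nat_finite[OF T(1)] by (auto simp: atLeast0LessThan)
  show "\<exists>(k :: nat) (\<alpha> :: nat \<Rightarrow> real) p.
    (\<forall>i<k. p i \<in> S) \<and> (\<Sum>i<k. \<alpha> i) = 1 \<and> x = (\<Sum>i<k. \<alpha> i *\<^sub>R p i)"
  proof (intro exI conjI allI impI)
    show "p i \<in> S" if "i < card T" for i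
      using that bij_betwE[OF p] T(2) by auto
    show "(\<Sum>i<card T. u (p i)) = 1"
      using sum.reindex_bij_betw[OF p, of u] T(3) by simp
    show "x = (\<Sum>i<card T. u (p i) *\<^sub>R p i)"
      using sum.reindex_bij_betw[OF p, of "\<lambda>v. u v *\<^sub>R v"] T(4) by simp
  qed
next
  assume "\<exists>(k :: nat) (\<alpha> :: nat \<Rightarrow> real) p.
    (\<forall>i<k. p i \<in> S) \<and> (\<Sum>i<k. \<alpha> i) = 1 \<and> x = (\<Sum>i<k. \<alpha> i *\<^sub>R p i)"
  then obtain k :: nat and \<alpha> :: "nat \<Rightarrow> real" and p where
    p: "\<And>i. i < k \<Longrightarrow> p i \<in> S" and \<alpha>: "(\<Sum>i<k. \<alpha> i) = 1" and x: "x = (\<Sum>i<k. \<alpha> i *\<^sub>R p i)" by blast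
  have "0 < k" using \<alpha> by (cases k) auto
  then have p0: "p 0 \<in> affine hull S" using p by (simp add: hull_inc)
  \<comment> \<open>As the weights add up to 1, moving \<open>p 0\<close> to the origin turns the affine combination into a
      linear one, in which repeated points do no harm.\<close>
  let ?L = "(\<lambda>x. x - p 0) ` (affine hull S)"
  have L: "subspace ?L" by (rule affine_diffs_subspace_subtract[OF affine_affine_hull p0])
  have "(\<Sum>i<k. \<alpha> i *\<^sub>R (p i - p 0)) \<in> ?L"
    by (rule subspace_sum[OF L], rule subspace_scale[OF L]) (use p in \<open>auto intro: hull_inc\<close>)
  also have "(\<Sum>i<k. \<alpha> i *\<^sub>R (p i - p 0)) = x - p 0"
    by (simp add: x scaleR_diff_right sum_subtractf \<alpha> flip: scaleR_sum_left)
  finally show "x \<in> affine hull S" by auto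
qed

text \<open>
  Projecting modulo null functions is linear, so it commutes with affine combinations of logarithms,
  and it does not change the rescaled stochastic matrix.
\<close>
lemma e_hull_eq_stoch_exp_affine_hull:
  assumes sc: "strongly_connected_digraph E" and ne: "E \<noteq> {}" and V: "V \<subseteq> stochastic_matrices E"
  shows "e_hull E V = stoch_exp E ` (affine hull (log_class E ` V))"
proof -
  have log_sum: "mod_null E (\<Sum>i<k. \<alpha> i *\<^sub>R edge_ln E (P i)) = (\<Sum>i<k. \<alpha> i *\<^sub>R log_class E (P i))"
    for k :: nat and \<alpha> :: "nat \<Rightarrow> real" and P
    by (simp add: log_class_def linear_sum[OF linear_mod_null] linear_scale[OF linear_mod_null])
  show ?thesis
  proof (intro equalityI subsetI)
    fix R assume "R \<in> e_hull E V"
    then obtain Q k and \<alpha> :: "nat \<Rightarrow> real" and P where R: "R = stoch_rescale Q"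
      and Q: "Q \<in> positive_edge_functions E" and P: "\<And>i. i < k \<Longrightarrow> P i \<in> V"
      and \<alpha>: "(\<Sum>i<k. \<alpha> i) = 1" and ln: "edge_ln E Q = (\<Sum>i<k. \<alpha> i *\<^sub>R edge_ln E (P i))"
      unfolding e_hull_def by auto
    have "R = stoch_exp E (edge_ln E Q)" by (simp add: R stoch_exp_def edge_exp_edge_ln Q)
    also have "\<dots> = stoch_exp E (mod_null E (edge_ln E Q))"
      by (simp add: stoch_exp_mod_null[OF sc ne] edge_ln_in_edge_functions)
    also have "mod_null E (edge_ln E Q) = (\<Sum>i<k. \<alpha> i *\<^sub>R log_class E (P i))"
      unfolding ln log_sum ..
    finally have "R = stoch_exp E (\<Sum>i<k. \<alpha> i *\<^sub>R log_class E (P i))" .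
    moreover have "(\<Sum>i<k. \<alpha> i *\<^sub>R log_class E (P i)) \<in> affine hull (log_class E ` V)"
      unfolding affine_hull_iff_nat_indexed
      by (intro exI[of _ k] exI[of _ \<alpha>] exI[of _ "\<lambda>i. log_class E (P i)"]) (use P \<alpha> in auto)
    ultimately show "R \<in> stoch_exp E ` (affine hull (log_class E ` V))" by blast
  next
    fix R assume "R \<in> stoch_exp E ` (affine hull (log_class E ` V))"
    then obtain F where "F \<in> affine hull (log_class E ` V)" and R: "R = stoch_exp E F" by blast
    then obtain k and \<alpha> :: "nat \<Rightarrow> real" and p where p: "\<forall>i<k. p i \<in> log_class E ` V"
      and \<alpha>: "(\<Sum>i<k. \<alpha> i) = 1" and F: "F = (\<Sum>i<k. \<alpha> i *\<^sub>R p i)"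
      unfolding affine_hull_iff_nat_indexed by blast
    from p have "\<forall>i. \<exists>P. i < k \<longrightarrow> P \<in> V \<and> p i = log_class E P" by blast
    then obtain P where P: "\<And>i. i < k \<Longrightarrow> P i \<in> V \<and> p i = log_class E (P i)" by metis
    define K where "K = (\<Sum>i<k. \<alpha> i *\<^sub>R edge_ln E (P i))"
    have K: "K \<in> edge_functions E"
      unfolding K_def
      by (intro subspace_sum subspace_scale subspace_edge_functions edge_ln_in_edge_functions)
    have "R = stoch_exp E (mod_null E K)" unfolding R F K_def log_sum using P by simp
    then have "R = stoch_rescale (edge_exp E K)"
      unfolding stoch_exp_mod_null[OF sc ne K] unfolding stoch_exp_def .
    moreover have "edge_ln E (edge_exp E K) = (\<Sum>i<k. \<alpha> i *\<^sub>R edge_ln E (P i))"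
      using edge_ln_edge_exp[OF K] by (simp add: K_def)
    ultimately show "R \<in> e_hull E V"
      unfolding e_hull_def using \<alpha> P edge_exp_positive by blast
  qed
qed

lemma affine_hull_log_class:
  assumes "F \<in> affine hull (log_class E ` V)"
  shows "F \<in> edge_functions E" "mod_null E F = F"
proof -
  have "subspace (edge_functions E \<inter> {F. mod_null E F = F})"
    using subspace_edge_functions[of E] linear_mod_null[of E]
    by (auto simp: subspace_def linear_0 linear_add linear_scale)
  then have "affine hull (log_class E ` V) \<subseteq> edge_functions E \<inter> {F. mod_null E F = F}"
    by (intro hull_minimal)
      (auto simp: subspace_imp_affine log_class_in_edge_functions mod_null_log_class)
  with assms show "F \<in> edge_functions E" "mod_null E F = F" by auto
qed

text \<open>
  The definite description in \<open>e_dim\<close> is meaningful here: the e-hull is an e-family, and only one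
  dimension is possible.
\<close>
lemma aff_dim_eq_e_dim_e_hull:
  assumes sc: "strongly_connected_digraph E" and ne: "E \<noteq> {}"
    and V: "V \<subseteq> stochastic_matrices E" "V \<noteq> {}"
  shows "aff_dim (affine hull (log_class E ` V)) = int (e_dim E (e_hull E V))"
proof -
  let ?B = "affine hull (log_class E ` V)"
  obtain b where b: "b \<in> ?B" using V(2) by (metis all_not_in_conv image_is_empty affine_hull_eq_empty)
  have hull: "e_hull E V = stoch_exp E ` ?B" by (rule e_hull_eq_stoch_exp_affine_hull[OF sc ne V(1)])
  have "log_class E ` e_hull E V = ?B"
    unfolding hull image_image
    by (simp add: log_class_stoch_exp[OF sc ne] affine_hull_log_class cong: image_cong)
  then have unique: "int n = aff_dim ?B" if "e_family E n (e_hull E V)" for n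
    using e_family_aff_dim_log_class[OF sc ne that] by simp
  have "e_family E (nat (aff_dim ?B)) (e_hull E V)"
    unfolding hull
    by (rule e_family_stoch_exp_affine[OF sc ne _ b]) (auto intro: affine_hull_log_class)
  then have "e_family E (e_dim E (e_hull E V)) (e_hull E V)"
    unfolding e_dim_def by (rule theI) (use unique in fastforce)
  from unique[OF this] show ?thesis by simp
qed

section \<open>Submanifolds of full dimension and linear constraints\<close>
lemma smooth_map_imp_continuous_on:
  assumes "smooth_map f A"
  shows "continuous_on A f"
  unfolding continuous_on_eq_continuous_within
proof
  fix x assume x: "x \<in> A"
  then obtain U g where U: "open U" "x \<in> U" "\<forall>k. Ck_on k g U" "\<forall>y\<in>U \<inter> A. g y = f y"
    using assms by (auto simp: smooth_map_def)
  have "continuous_on U g" using spec[OF U(3), of 0] by simp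
  then have "continuous_on (A \<inter> U) f"
    by (rule continuous_on_eq[OF continuous_on_subset]) (use U(4) in auto)
  then have "continuous (at x within A \<inter> U) f"
    using x U(2) by (simp add: continuous_on_eq_continuous_within)
  then show "continuous (at x within A) f"
    using at_within_nhd[OF U(2,1), of "A \<inter> U" A] by (simp add: Int_assoc)
qed

text \<open>
  A slice chart parametrises a neighbourhood of a point of \<open>S\<close> by an open subset of a
  \<open>d\<close>-dimensional vector space. Composed with \<open>f\<close> this is a continuous injection into an affine space
  of the same dimension, whose image is open by invariance of domain.
\<close>
lemma openin_image_embedded_submanifold:
  fixes f :: "'a::euclidean_space \<Rightarrow> 'b::euclidean_space"
  assumes emb: "embedded_submanifold M d S"
    and cont: "continuous_on M f" and inj: "inj_on f M"
    and B: "affine B" "aff_dim B = int d" "f ` S \<subseteq> B"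
  shows "openin (top_of_set B) (f ` S)"
proof -
  have "\<exists>W. openin (top_of_set B) W \<and> f p \<in> W \<and> W \<subseteq> f ` S" if p: "p \<in> S" for p
  proof -
    obtain U D T and \<phi> \<psi> :: "'a \<Rightarrow> 'a" where U: "openin (top_of_set M) U" "p \<in> U"
      and D: "openin (top_of_set D) (\<phi> ` U)"
      and \<psi>: "smooth_map \<psi> (\<phi> ` U)" "\<And>x. x \<in> U \<Longrightarrow> \<psi> (\<phi> x) = x"
      and T: "subspace T" "T \<subseteq> D" "dim T = d" and slice: "\<phi> ` (U \<inter> S) = \<phi> ` U \<inter> T"
      using emb p unfolding embedded_submanifold_def by metis
    have "U \<subseteq> M" using U(1) by (rule openin_imp_subset)
    have im: "\<psi> ` (\<phi> ` U \<inter> T) = U \<inter> S"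
      unfolding slice[symmetric] image_image by (auto simp: \<psi>(2))
    have "openin (top_of_set B) ((f \<circ> \<psi>) ` (\<phi> ` U \<inter> T))"
    proof (rule invariance_of_domain_affine_sets)
      show "openin (top_of_set T) (\<phi> ` U \<inter> T)"
        using D T(2) unfolding openin_open by blast
      show "affine T" using T(1) by (rule subspace_imp_affine)
      show "affine B" by (rule B(1))
      show "aff_dim B \<le> aff_dim T" using aff_dim_subspace[OF T(1)] T(3) B(2) by simp
      show "continuous_on (\<phi> ` U \<inter> T) (f \<circ> \<psi>)"
      proof (rule continuous_on_compose)
        show "continuous_on (\<phi> ` U \<inter> T) \<psi>"
          using smooth_map_imp_continuous_on[OF \<psi>(1)] by (rule continuous_on_subset) auto
        show "continuous_on (\<psi> ` (\<phi> ` U \<inter> T)) f"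
          using cont \<open>U \<subseteq> M\<close> by (auto simp: im intro: continuous_on_subset)
      qed
      show "f \<circ> \<psi> \<in> \<phi> ` U \<inter> T \<rightarrow> B"
      proof
        fix x assume "x \<in> \<phi> ` U \<inter> T"
        then have "\<psi> x \<in> S" using im by blast
        then show "(f \<circ> \<psi>) x \<in> B" using B(3) by auto
      qed
      show "inj_on (f \<circ> \<psi>) (\<phi> ` U \<inter> T)"
      proof (rule comp_inj_on)
        show "inj_on \<psi> (\<phi> ` U \<inter> T)" by (auto intro!: inj_onI simp: \<psi>(2))
        show "inj_on f (\<psi> ` (\<phi> ` U \<inter> T))"
          unfolding im using inj \<open>U \<subseteq> M\<close> by (auto intro: inj_on_subset)
      qed
    qed
    then have "openin (top_of_set B) (f ` (U \<inter> S))" by (simp only: image_comp[symmetric] im)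
    then show ?thesis using p U(2) by blast
  qed
  then show ?thesis by (subst openin_subopen) blast
qed

text \<open>
  Such a fibre is an affine subset of a finite-dimensional space.
\<close>
lemma closed_linear_fibre:
  fixes X :: "'a::euclidean_space set" and h :: "'a \<Rightarrow> 'b::real_vector"
  assumes "subspace X" and "linear_map_on X h"
  shows "closed {x \<in> X. h x = C}"
proof -
  have "affine {x \<in> X. h x = C}"
    unfolding affine_def
  proof (intro ballI allI impI)
    fix x y and u v :: real assume x: "x \<in> {x \<in> X. h x = C}" and y: "y \<in> {x \<in> X. h x = C}" and "u + v = 1"
    then have "h (u *\<^sub>R x + v *\<^sub>R y) = u *\<^sub>R C + v *\<^sub>R C"
      using assms by (auto simp: linear_map_on_def subspace_scale)
    also have "\<dots> = C" using \<open>u + v = 1\<close> by (metis scaleR_add_left scaleR_one)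
    finally show "u *\<^sub>R x + v *\<^sub>R y \<in> {x \<in> X. h x = C}"
      using x y assms(1) by (auto intro: subspace_add subspace_scale)
  qed
  then show ?thesis by (rule affine_closed)
qed

theorem theorem4p2:
  fixes E :: "('y::finite \<times> 'y) set"
    and V :: "(real^'y^'y) set"
    and d :: nat
    and \<phi> :: "real^'y^'y \<Rightarrow> 'u::{real_vector, topological_ab_group_add, t2_space}"
    and C :: 'u
  assumes "E \<noteq> {}"
    and "strongly_connected_digraph E"
    and "V \<noteq> {}"
    and "embedded_submanifold (stochastic_matrices E) d V"
    and "d = e_dim E (e_hull E V)"
    and "continuous_on UNIV (\<lambda>(c :: real, u :: 'u). c *\<^sub>R u)"
    and "\<exists>B :: 'u set. finite B \<and> span B = UNIV"
    and "linear_map_on (edge_functions E) \<phi>"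
    and "V = stochastic_matrices E \<inter> {F \<in> edge_functions E. \<phi> F = C}"
  shows "\<exists>d'. e_family E d' V"
proof -
  note ne = assms(1) and sc = assms(2) and V = assms(9)
  define B where "B = affine hull (log_class E ` V)"
  have VW: "V \<subseteq> stochastic_matrices E" using V by blast
  have sub: "log_class E ` V \<subseteq> B" unfolding B_def by (rule hull_subset)
  have B: "affine B" "aff_dim B = int d"
    using aff_dim_eq_e_dim_e_hull[OF sc ne VW assms(3)] assms(5) by (simp_all add: B_def)
  have B_class: "F \<in> edge_functions E" "mod_null E F = F" if "F \<in> B" for F
    using affine_hull_log_class that unfolding B_def by blast+
  have "continuous_on (stochastic_matrices E) (log_class E)"
    using continuous_on_log_class by (rule continuous_on_subset) (use stochastic_matricesD(1) in auto)
  then have opn: "openin (top_of_set B) (log_class E ` V)"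
    by (rule openin_image_embedded_submanifold[OF assms(4) _ inj_on_log_class[OF sc] B sub])
  \<comment> \<open>In logarithmic coordinates \<open>V\<close> is the part of \<open>B\<close> where the linear constraint holds for the
      stochastic matrix with these coordinates.\<close>
  have "log_class E ` V = B \<inter> stoch_exp E -` {F \<in> edge_functions E. \<phi> F = C}"
  proof (intro equalityI subsetI)
    fix b assume "b \<in> log_class E ` V"
    then show "b \<in> B \<inter> stoch_exp E -` {F \<in> edge_functions E. \<phi> F = C}"
      using sub V by (auto simp: stoch_exp_log_class[OF sc ne])
  next
    fix b assume b: "b \<in> B \<inter> stoch_exp E -` {F \<in> edge_functions E. \<phi> F = C}"
    then have "stoch_exp E b \<in> V" using V stoch_exp_stochastic[OF sc ne] by blast
    moreover have "log_class E (stoch_exp E b) = b"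
      using b B_class by (simp add: log_class_stoch_exp[OF sc ne])
    ultimately show "b \<in> log_class E ` V" by (metis imageI)
  qed
  then have "closedin (top_of_set B) (log_class E ` V)"
    using continuous_closedin_preimage[OF continuous_on_stoch_exp[OF sc ne]
        closed_linear_fibre[OF subspace_edge_functions assms(8)]] by simp
  moreover have "connected B" using B(1) by (simp add: affine_imp_convex convex_connected)
  ultimately have img: "log_class E ` V = B"
    using opn assms(3) unfolding connected_clopen by blast
  have "V = stoch_exp E ` log_class E ` V"
    unfolding image_image using VW by (force simp: stoch_exp_log_class[OF sc ne])
  then have VB: "V = stoch_exp E ` B" by (simp only: img)
  obtain b where "b \<in> B" using img assms(3) by blast
  then have "e_family E (nat (aff_dim B)) V"
    unfolding VB by (intro e_family_stoch_exp_affine[OF sc ne B(1)]) (use B_class in auto)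
  then show ?thesis by blast
qed

end
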